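(* Let $W:\mathbb{R}\to\mathbb{R}$ be a double-well potential such that: (1) $W$ is continuous; (2) $W\ge0$ and $W(z)=0$ if and only if $z=\pm1$; (3) $\liminf_{z\to\pm\infty}W(z)>0$. For $s\in(\frac12,1)$ let $$m_s=\inf\left\{\int_{\mathbb{R}}W(u)\,dt+\iint_{\mathbb{R}\times\mathbb{R}}\frac{|u(x)-u(y)|^2}{|x-y|^{1+2s}}\,dx\,dy\ :\ u\in H^s_{\mathrm{loc}}(\mathbb{R}),\ u(\pm\infty)=\pm1\right\}.$$ Then $$\lim_{s\to\frac12^+}(2s-1)\,m_s=m_{\frac12},$$ where $m_{\frac12}=8$.
   Context: For $s>\frac12$ functions in $H^s_{\mathrm{loc}}(\mathbb{R})$ are identified with their continuous representatives; $u(\pm\infty)=\pm1$ means $\lim_{x\to+\infty}u(x)=1$ and $\lim_{x\to-\infty}u(x)=-1$. *)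

theory Defs
  imports "HOL-Analysis.Analysis"
begin

definition gagliardo_energy :: "real \<Rightarrow> real set \<Rightarrow> (real \<Rightarrow> real) \<Rightarrow> ennreal" where
  "gagliardo_energy s A u =
     (\<integral>\<^sup>+ p \<in> A \<times> A. ennreal (\<bar>u (fst p) - u (snd p)\<bar>\<^sup>2 / \<bar>fst p - snd p\<bar> powr (1 + 2 * s))
        \<partial>(lborel \<Otimes>\<^sub>M lborel))"

text \<open>
  The fractional Sobolev (Slobodeckij) class of order \<open>s\<close>, for \<open>0 < s < 1\<close>, as a set of
  functions rather than of a.e.-equivalence classes.
\<close>

definition Hs_on :: "real \<Rightarrow> real set \<Rightarrow> (real \<Rightarrow> real) set" where
  "Hs_on s A = {u. set_borel_measurable lborel A u \<and>
     (\<integral>\<^sup>+ x \<in> A. ennreal (\<bar>u x\<bar>\<^sup>2) \<partial>lborel) < \<infinity> \<and> gagliardo_energy s A u < \<infinity>}"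

definition Hs_loc :: "real \<Rightarrow> (real \<Rightarrow> real) set" where
  "Hs_loc s = {u. \<forall>a b. a < b \<longrightarrow> u \<in> Hs_on s {a<..<b}}"

text \<open>
  For \<open>s > 1/2\<close> a class in \<open>Hs_loc s\<close> is identified with its continuous representative; this is
  the continuity requirement below, which gives the limits at \<open>\<plusminus>\<infinity>\<close> a pointwise meaning.
\<close>

definition transitions :: "real \<Rightarrow> (real \<Rightarrow> real) set" where
  "transitions s = {u \<in> Hs_loc s. continuous_on UNIV u \<and>
     (u \<longlongrightarrow> 1) at_top \<and> (u \<longlongrightarrow> -1) at_bot}"

definition transition_cost :: "(real \<Rightarrow> real) \<Rightarrow> real \<Rightarrow> ennreal" where
  "transition_cost W s =
     (INF u \<in> transitions s. (\<integral>\<^sup>+ t. ennreal (W (u t)) \<partial>lborel) + gagliardo_energy s UNIV u)"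

end

theory Submission
  imports Defs "HOL-Real_Asymp.Real_Asymp"
begin

text \<open>
  Writing \<open>y = x + h\<close>, the Gagliardo energy is
  \<open>2 \<integral>\<^sub>0\<^sup>\<infinity> h powr (-1 - 2s) D(h) dh\<close> with \<open>D(h) = \<integral> \<bar>u(x + h) - u(x)\<bar>\<^sup>2 dx\<close>.
  For the upper bound, a piecewise linear ramp has \<open>D(h) \<le> 4h + 8\<close>, and only the term \<open>4h\<close>
  contributes at order \<open>1 / (2s - 1)\<close>. For the lower bound, a competitor of energy at most
  \<open>8 / (2s - 1)\<close> has \<open>\<bar>u\<bar> \<le> 1 - d\<close> on a set of measure at most \<open>L = K / (2s - 1)\<close>, and
  telescoping gives \<open>D(h) \<ge> 4 (1 - d)\<^sup>2 (h - L)\<close>. Integrating over \<open>h \<ge> L\<close> produces the factor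
  \<open>L powr (1 - 2s)\<close>, which tends to 1.
\<close>

section \<open>The energy as a weighted integral over shifts\<close>

text \<open>Tonelli makes the shift \<open>h\<close> the outer variable. By translation invariance
  the inner integral is even in \<open>h\<close>, so the negative shifts merely double the positive
  ones.\<close>

lemma gagliardo_energy_UNIV_eq:
  fixes u :: "real \<Rightarrow> real"
  assumes [measurable]: "u \<in> borel_measurable borel"
  shows "gagliardo_energy s UNIV u =
    2 * (\<integral>\<^sup>+h\<in>{0<..}. ennreal (h powr (-1 - 2 * s)) *
          (\<integral>\<^sup>+x. ennreal ((u (x + h) - u x)\<^sup>2) \<partial>lborel) \<partial>lborel)"
proof -
  define D where "D h = (\<integral>\<^sup>+x. ennreal ((u (x + h) - u x)\<^sup>2) \<partial>lborel)" for h
  define G where "G h = ennreal (\<bar>h\<bar> powr (-1 - 2 * s)) * D h" for h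
  have mD [measurable]: "D \<in> borel_measurable borel"
    unfolding D_def by measurable
  have mG [measurable]: "G \<in> borel_measurable borel"
    unfolding G_def by measurable
  have D_neg: "D (-h) = D h" for h
  proof -
    have "D (-h) = (\<integral>\<^sup>+x. ennreal ((u (h + 1 * x + (-h)) - u (h + 1 * x))\<^sup>2) \<partial>lborel)"
      unfolding D_def by (subst nn_integral_real_affine[where c=1 and t=h]) auto
    also have "\<dots> = D h"
      unfolding D_def by (intro nn_integral_cong) (simp add: power2_commute add.commute)
    finally show ?thesis .
  qed
  have kern: "(u x - u (x + h))\<^sup>2 / \<bar>x - (x + h)\<bar> powr (1 + 2 * s)
      = \<bar>h\<bar> powr (-1 - 2 * s) * (u (x + h) - u x)\<^sup>2" for x h
  proof -
    have "\<bar>h\<bar> powr (-1 - 2 * s) = inverse (\<bar>h\<bar> powr (1 + 2 * s))"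
      by (simp flip: powr_minus)
    then show ?thesis by (simp add: divide_simps power2_commute)
  qed
  have "gagliardo_energy s UNIV u =
      (\<integral>\<^sup>+x. \<integral>\<^sup>+y. ennreal ((u x - u y)\<^sup>2 / \<bar>x - y\<bar> powr (1 + 2 * s)) \<partial>lborel \<partial>lborel)"
    unfolding gagliardo_energy_def by (subst lborel.nn_integral_fst[symmetric]) auto
  also have "\<dots> = (\<integral>\<^sup>+x. \<integral>\<^sup>+h. ennreal (\<bar>h\<bar> powr (-1 - 2 * s) * (u (x + h) - u x)\<^sup>2) \<partial>lborel \<partial>lborel)"
  proof (rule nn_integral_cong)
    fix x :: real
    have "(\<integral>\<^sup>+y. ennreal ((u x - u y)\<^sup>2 / \<bar>x - y\<bar> powr (1 + 2 * s)) \<partial>lborel)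
      = (\<integral>\<^sup>+h. ennreal ((u x - u (x + 1 * h))\<^sup>2 / \<bar>x - (x + 1 * h)\<bar> powr (1 + 2 * s)) \<partial>lborel)"
      by (subst nn_integral_real_affine[where c=1 and t=x]) auto
    then show "(\<integral>\<^sup>+y. ennreal ((u x - u y)\<^sup>2 / \<bar>x - y\<bar> powr (1 + 2 * s)) \<partial>lborel)
      = (\<integral>\<^sup>+h. ennreal (\<bar>h\<bar> powr (-1 - 2 * s) * (u (x + h) - u x)\<^sup>2) \<partial>lborel)"
      unfolding mult_1 kern .
  qed
  also have "\<dots> = (\<integral>\<^sup>+h. \<integral>\<^sup>+x. ennreal (\<bar>h\<bar> powr (-1 - 2 * s) * (u (x + h) - u x)\<^sup>2) \<partial>lborel \<partial>lborel)"
    by (rule lborel_pair.Fubini') measurable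
  also have "\<dots> = (\<integral>\<^sup>+h. G h \<partial>lborel)"
    unfolding G_def D_def by (simp add: ennreal_mult nn_integral_cmult)
  \<comment> \<open>The point \<open>h = 0\<close> lies in neither half-line; nothing is lost there,
    because \<open>0 powr a = 0\<close> gives \<open>G 0 = 0\<close>.\<close>
  also have "\<dots> = (\<integral>\<^sup>+h. G h * indicator {0<..} h + G h * indicator {..<0} h \<partial>lborel)"
    by (intro nn_integral_cong) (auto simp: G_def indicator_def)
  also have "\<dots> = (\<integral>\<^sup>+h\<in>{0<..}. G h \<partial>lborel) + (\<integral>\<^sup>+h\<in>{..<0}. G h \<partial>lborel)"
    by (intro nn_integral_add) auto
  also have "(\<integral>\<^sup>+h\<in>{..<0}. G h \<partial>lborel) = (\<integral>\<^sup>+h\<in>{0<..}. G h \<partial>lborel)"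
    by (subst nn_integral_real_affine[where c="-1" and t=0])
       (auto simp: G_def D_neg indicator_def intro!: nn_integral_cong)
  also have "(\<integral>\<^sup>+h\<in>{0<..}. G h \<partial>lborel) =
      (\<integral>\<^sup>+h\<in>{0<..}. ennreal (h powr (-1 - 2 * s)) * D h \<partial>lborel)"
    by (intro nn_integral_cong) (auto simp: G_def indicator_def)
  finally show ?thesis unfolding D_def mult_2 .
qed

section \<open>Lower bound for the energy\<close>

text \<open>Telescoping: the indicator of \<open>A\<close> gains mass \<open>h\<close> under a shift by \<open>h\<close>, and a point that
  enters \<open>A\<close> comes either from \<open>B\<close> or from the gap.\<close>
lemma shift_transition_measure:
  fixes A B :: "real set"
  assumes [measurable]: "A \<in> sets borel" "B \<in> sets borel" and disj: "A \<inter> B = {}"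
    and B: "{..<-R} \<subseteq> B" and A: "{R..} \<subseteq> A" and R: "R \<ge> 0" and h: "h \<ge> 0"
  shows "ennreal h \<le> emeasure lborel {x \<in> B. x + h \<in> A} + emeasure lborel (- (A \<union> B))"
proof -
  let ?\<mu> = "emeasure lborel"
  define T where "T = {x \<in> B. x + h \<in> A}"
  have [measurable]: "T \<in> sets borel" unfolding T_def by measurable
  \<comment> \<open>\<open>A\<close> itself has infinite measure. Truncating to a window makes the
    mass finite, so that it can be cancelled in \<open>ennreal\<close> at the end.\<close>
  have fin: "?\<mu> (A \<inter> {-R..<R}) < \<infinity>"
  proof -
    have "?\<mu> (A \<inter> {-R..<R}) \<le> ?\<mu> {-R..<R}" by (intro emeasure_mono) auto
    also have "\<dots> < \<infinity>" using R by simp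
    finally show ?thesis .
  qed
  have "?\<mu> (A \<inter> {-R..<R}) + ennreal h = ?\<mu> (A \<inter> {-R..<R}) + ?\<mu> {R..<R+h}"
    using h by simp
  also have "\<dots> = ?\<mu> (A \<inter> {-R..<R} \<union> {R..<R+h})"
    by (intro plus_emeasure) auto
  also have "\<dots> \<le> ?\<mu> (A \<inter> {-R..<R+h})"
    using A R h by (intro emeasure_mono) auto
  also have "\<dots> = (\<integral>\<^sup>+x. indicator (A \<inter> {-R..<R+h}) x \<partial>lborel)" by simp
  also have "\<dots> = (\<integral>\<^sup>+x. indicator (A \<inter> {-R..<R+h}) (h + 1 * x) \<partial>lborel)"
    by (subst nn_integral_real_affine[where c=1 and t=h]) auto
  also have "\<dots> = (\<integral>\<^sup>+x. indicator {x. x + h \<in> A \<and> -R \<le> x + h \<and> x < R} x \<partial>lborel)"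
    by (intro nn_integral_cong) (auto simp: indicator_def add.commute)
  also have "\<dots> = ?\<mu> {x. x + h \<in> A \<and> -R \<le> x + h \<and> x < R}" by (subst nn_integral_indicator) auto
  \<comment> \<open>Such an \<open>x\<close> is in \<open>A\<close>, in \<open>B\<close> or in the
    gap. If it is in \<open>A\<close>, then \<open>x \<ge> -R\<close>, since points below
    \<open>-R\<close> lie in \<open>B\<close>; if it is in \<open>B\<close>, it belongs to
    \<open>T\<close>.\<close>
  also have "\<dots> \<le> ?\<mu> (A \<inter> {-R..<R} \<union> (T \<union> - (A \<union> B)))"
    using disj B by (intro emeasure_mono) (auto simp: T_def not_le[symmetric])
  also have "\<dots> \<le> ?\<mu> (A \<inter> {-R..<R}) + ?\<mu> (T \<union> - (A \<union> B))"
    by (intro emeasure_subadditive) auto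
  finally have "ennreal h \<le> ?\<mu> (T \<union> - (A \<union> B))"
    using fin by (auto simp only: ennreal_add_left_cancel_le)
  also have "\<dots> \<le> ?\<mu> T + ?\<mu> (- (A \<union> B))"
    by (intro emeasure_subadditive) auto
  finally show ?thesis unfolding T_def .
qed

lemma nn_integral_powr_tail:
  fixes a L :: real
  assumes "a < -1" "L > 0"
  shows "(\<integral>\<^sup>+h\<in>{L..}. ennreal (h powr a) \<partial>lborel) = ennreal (L powr (a + 1) / (-a - 1))"
proof -
  have "(\<integral>\<^sup>+h. ennreal (h powr a) * indicator {L..} h \<partial>lborel)
      = ennreal (0 - L powr (a + 1) / (a + 1))"
  proof (rule nn_integral_FTC_atLeast)
    show "((\<lambda>x. x powr (a + 1) / (a + 1)) \<longlongrightarrow> 0) at_top"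
      using assms by real_asymp
    show "((\<lambda>x. x powr (a + 1) / (a + 1)) has_real_derivative x powr a) (at x)" if "L \<le> x" for x
      using that assms by (auto intro!: derivative_eq_intros)
  qed auto
  also have "0 - L powr (a + 1) / (a + 1) = L powr (a + 1) / (-a - 1)"
    using assms by (simp add: divide_simps) (simp add: algebra_simps)
  finally show ?thesis .
qed

text \<open>This pairs the kernel with \<open>h - L\<close>, the growth in \<open>h\<close> that
  telescoping guarantees. The factor \<open>1 / (2 * s - 1)\<close> comes from the slow decay of
  \<open>h powr (-2 * s)\<close> at infinity.\<close>

lemma nn_integral_excess_powr_tail:
  fixes s L :: real
  assumes s: "1/2 < s" and L: "0 < L"
  shows "(\<integral>\<^sup>+h\<in>{L..}. ennreal (h powr (-1 - 2 * s) * (h - L)) \<partial>lborel)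
    = ennreal (L powr (1 - 2 * s) / (2 * s * (2 * s - 1)))"
proof -
  \<comment> \<open>Termwise antiderivative of
    \<open>h powr (-2 * s) - L * h powr (-1 - 2 * s)\<close>. Both exponents in \<open>F\<close> are
    negative for \<open>s > 1/2\<close>, so only the endpoint \<open>L\<close> contributes.\<close>
  define F where "F h = L * h powr (-2 * s) / (2 * s) - h powr (1 - 2 * s) / (2 * s - 1)" for h
  have "(\<integral>\<^sup>+h\<in>{L..}. ennreal (h powr (-1 - 2 * s) * (h - L)) \<partial>lborel) = ennreal (0 - F L)"
  proof (rule nn_integral_FTC_atLeast)
    show "(F \<longlongrightarrow> 0) at_top"
    proof -
      have "((\<lambda>h::real. h powr (-2 * s)) \<longlongrightarrow> 0) at_top" "((\<lambda>h::real. h powr (1 - 2 * s)) \<longlongrightarrow> 0) at_top"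
        using s by real_asymp+
      from tendsto_diff[OF tendsto_mult_left[OF this(1), of "L / (2 * s)"]
          tendsto_mult_left[OF this(2), of "1 / (2 * s - 1)"]]
      show ?thesis by (simp add: F_def[abs_def])
    qed
    show "(F has_real_derivative x powr (-1 - 2 * s) * (x - L)) (at x)" if "L \<le> x" for x
    proof -
      have x: "x > 0" using that L by simp
      have "x powr (1 - 2 * s - 1) = x powr (-1 - 2 * s) * x" "x powr (-2 * s - 1) = x powr (-1 - 2 * s)"
        using x powr_add[of x "-1 - 2 * s" 1] by (simp_all add: algebra_simps minus_diff_commute)
      then have eq: "- (L * x powr (-2 * s - 1)) - (- (x powr (1 - 2 * s - 1))) = x powr (-1 - 2 * s) * (x - L)"
        by (simp add: algebra_simps)
      have "((\<lambda>h. L * h powr (-2 * s) / (2 * s)) has_real_derivative - (L * x powr (-2 * s - 1))) (at x)"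
        "((\<lambda>h. h powr (1 - 2 * s) / (2 * s - 1)) has_real_derivative - (x powr (1 - 2 * s - 1))) (at x)"
        using s
        by (auto intro!: DERIV_cong[OF DERIV_cdivide[OF DERIV_cmult[OF has_real_derivative_powr[OF x]]]]
              DERIV_cong[OF DERIV_cdivide[OF has_real_derivative_powr[OF x]]] simp: field_simps)
      from DERIV_diff[OF this] show ?thesis
        unfolding F_def[abs_def] eq .
    qed
  qed (auto simp: L)
  also have "0 - F L = L powr (1 - 2 * s) / (2 * s * (2 * s - 1))"
  proof -
    have "L * L powr (-2 * s) = L powr (1 - 2 * s)"
      using L powr_add[of L 1 "-2 * s"] by simp
    then show ?thesis unfolding F_def using s by (simp add: field_simps)
  qed
  finally show ?thesis .
qed

text \<open>The points outside \<open>A = {u > 1 - d}\<close> and \<open>B = {u < -1 + d}\<close>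
  form the gap, so telescoping leaves measure at least \<open>h - L\<close> of points where the
  shift by \<open>h\<close> raises \<open>u\<close> by at least \<open>2 * (1 - d)\<close>. Shifts
  below \<open>L\<close> are discarded. The limits of \<open>u\<close> only supply some
  \<open>R\<close>, and the bound does not depend on it.\<close>

lemma gagliardo_energy_ge:
  fixes u :: "real \<Rightarrow> real"
  assumes u: "continuous_on UNIV u" "(u \<longlongrightarrow> 1) at_top" "(u \<longlongrightarrow> -1) at_bot"
    and s: "1/2 < s" and L: "0 < L" and d: "0 < d" "d < 1"
    and gap: "emeasure lborel {x. -1 + d \<le> u x \<and> u x \<le> 1 - d} \<le> ennreal L"
  shows "ennreal (8 * (1 - d)\<^sup>2 * (L powr (1 - 2 * s) / (2 * s * (2 * s - 1)))) \<le> gagliardo_energy s UNIV u"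
proof -
  have [measurable]: "u \<in> borel_measurable borel"
    using u(1) by (rule borel_measurable_continuous_onI)
  define A B where "A = {x. u x > 1 - d}" and "B = {x. u x < -1 + d}"
  have [measurable]: "A \<in> sets borel" "B \<in> sets borel" unfolding A_def B_def by measurable
  have "eventually (\<lambda>x. u x > 1 - d) at_top" "eventually (\<lambda>x. u x < -1 + d) at_bot"
    using order_tendstoD(1)[OF u(2), of "1 - d"] order_tendstoD(2)[OF u(3), of "-1 + d"] d by auto
  then obtain R1 R2 where R1: "\<And>x. x \<ge> R1 \<Longrightarrow> u x > 1 - d" and R2: "\<And>x. x \<le> R2 \<Longrightarrow> u x < -1 + d"
    unfolding eventually_at_top_linorder eventually_at_bot_linorder by blast
  define R where "R = Max {0, R1, -R2}"
  have R: "R \<ge> 0" "R \<ge> R1" "-R \<le> R2" by (auto simp: R_def)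
  have D: "ennreal (4 * (1 - d)\<^sup>2 * (h - L)) \<le> (\<integral>\<^sup>+x. ennreal ((u (x + h) - u x)\<^sup>2) \<partial>lborel)"
    if h: "h \<ge> L" for h
  proof -
    define T where "T = {x \<in> B. x + h \<in> A}"
    have [measurable]: "T \<in> sets borel" unfolding T_def by measurable
    have "ennreal (h - L) + ennreal L = ennreal h"
      using h L by (simp flip: ennreal_plus)
    also have "\<dots> \<le> emeasure lborel T + emeasure lborel (- (A \<union> B))"
      unfolding T_def
      by (rule shift_transition_measure[where R=R]) (use R R1 R2 h L d in \<open>force simp: A_def B_def\<close>)+
    also have "- (A \<union> B) = {x. -1 + d \<le> u x \<and> u x \<le> 1 - d}"
      by (auto simp: A_def B_def)
    also have "emeasure lborel T + emeasure lborel {x. -1 + d \<le> u x \<and> u x \<le> 1 - d}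
        \<le> emeasure lborel T + ennreal L"
      using gap by (rule add_left_mono)
    finally have T: "ennreal (h - L) \<le> emeasure lborel T"
      by (simp add: ennreal_add_left_cancel_le add.commute[of _ "ennreal L"])
    have "ennreal (4 * (1 - d)\<^sup>2 * (h - L)) = ennreal (4 * (1 - d)\<^sup>2) * ennreal (h - L)"
      using h by (simp add: ennreal_mult)
    also have "\<dots> \<le> ennreal (4 * (1 - d)\<^sup>2) * emeasure lborel T"
      using T by (intro mult_left_mono) auto
    also have "\<dots> = (\<integral>\<^sup>+x. ennreal (4 * (1 - d)\<^sup>2) * indicator T x \<partial>lborel)"
      by (subst nn_integral_cmult_indicator) auto
    also have "\<dots> \<le> (\<integral>\<^sup>+x. ennreal ((u (x + h) - u x)\<^sup>2) \<partial>lborel)"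
    proof (intro nn_integral_mono)
      fix x
      have "4 * (1 - d)\<^sup>2 \<le> (u (x + h) - u x)\<^sup>2" if "x \<in> T"
      proof -
        have "2 * (1 - d) \<le> u (x + h) - u x" using that by (auto simp: T_def A_def B_def)
        then have "(2 * (1 - d))\<^sup>2 \<le> (u (x + h) - u x)\<^sup>2"
          using d by (intro power_mono) auto
        then show ?thesis by (simp only: power_mult_distrib) simp
      qed
      then show "ennreal (4 * (1 - d)\<^sup>2) * indicator T x \<le> ennreal ((u (x + h) - u x)\<^sup>2)"
        by (auto simp: indicator_def intro!: ennreal_leI)
    qed
    finally show ?thesis .
  qed
  have "ennreal (8 * (1 - d)\<^sup>2 * (L powr (1 - 2 * s) / (2 * s * (2 * s - 1))))
      = ennreal (2 * (4 * (1 - d)\<^sup>2)) * ennreal (L powr (1 - 2 * s) / (2 * s * (2 * s - 1)))"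
    using s by (subst ennreal_mult[symmetric]) auto
  also have "\<dots> = 2 * (ennreal (4 * (1 - d)\<^sup>2) *
      (\<integral>\<^sup>+h\<in>{L..}. ennreal (h powr (-1 - 2 * s) * (h - L)) \<partial>lborel))"
    unfolding nn_integral_excess_powr_tail[OF s L] by (subst ennreal_mult) (auto simp: mult.assoc)
  also have "\<dots> = 2 * (\<integral>\<^sup>+h. ennreal (4 * (1 - d)\<^sup>2) *
      (ennreal (h powr (-1 - 2 * s) * (h - L)) * indicator {L..} h) \<partial>lborel)"
    by (subst nn_integral_cmult) auto
  also have "\<dots> \<le> 2 * (\<integral>\<^sup>+h\<in>{0<..}. ennreal (h powr (-1 - 2 * s)) *
          (\<integral>\<^sup>+x. ennreal ((u (x + h) - u x)\<^sup>2) \<partial>lborel) \<partial>lborel)"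
  proof (intro mult_left_mono nn_integral_mono)
    fix h :: real
    show "ennreal (4 * (1 - d)\<^sup>2) * (ennreal (h powr (-1 - 2 * s) * (h - L)) * indicator {L..} h)
      \<le> ennreal (h powr (-1 - 2 * s)) * (\<integral>\<^sup>+x. ennreal ((u (x + h) - u x)\<^sup>2) \<partial>lborel) * indicator {0<..} h"
    proof (cases "h \<ge> L")
      case True
      have "ennreal (4 * (1 - d)\<^sup>2) * ennreal (h powr (-1 - 2 * s) * (h - L))
          = ennreal (h powr (-1 - 2 * s)) * ennreal (4 * (1 - d)\<^sup>2 * (h - L))"
        using True by (simp add: ennreal_mult[symmetric] mult_ac)
      also have "\<dots> \<le> ennreal (h powr (-1 - 2 * s)) * (\<integral>\<^sup>+x. ennreal ((u (x + h) - u x)\<^sup>2) \<partial>lborel)"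
        using D[OF True] by (intro mult_left_mono) auto
      finally show ?thesis using True L by (simp add: indicator_def)
    qed (auto simp: indicator_def)
  qed auto
  also have "\<dots> = gagliardo_energy s UNIV u"
    by (subst gagliardo_energy_UNIV_eq) auto
  finally show ?thesis .
qed

section \<open>Upper bound for the energy of a competitor\<close>

text \<open>One profile, independent of \<open>s\<close>, suffices: the leading term of the energy
  sees only the jump of 2 between the limits, while the shape of the transition affects terms that
  stay bounded as \<open>s\<close> tends to 1/2.\<close>

definition ramp :: "real \<Rightarrow> real" where
  "ramp x = max (-1) (min 1 x)"

lemma continuous_on_ramp: "continuous_on S ramp"
  unfolding ramp_def[abs_def] by (intro continuous_intros)

lemma borel_measurable_ramp [measurable]: "ramp \<in> borel_measurable borel"
  by (rule borel_measurable_continuous_onI[OF continuous_on_ramp])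

text \<open>The ramp is 1-Lipschitz with values in [-1, 1], hence \<open>min h 2\<close>, and its
  increment vanishes outside an interval of length \<open>2 + h\<close>. The bound is quadratic for
  small \<open>h\<close>, which tames the kernel at 0, and equals \<open>4 * h + 8\<close> once
  \<open>h \<ge> 2\<close>.\<close>

lemma ramp_increment_le:
  assumes "h > 0"
  shows "(\<integral>\<^sup>+x. ennreal ((ramp (x + h) - ramp x)\<^sup>2) \<partial>lborel) \<le> ennreal ((min h 2)\<^sup>2 * (2 + h))"
proof -
  have "(\<integral>\<^sup>+x. ennreal ((ramp (x + h) - ramp x)\<^sup>2) \<partial>lborel)
      \<le> (\<integral>\<^sup>+x. ennreal ((min h 2)\<^sup>2) * indicator {-1-h..1} x \<partial>lborel)"
  proof (intro nn_integral_mono)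
    fix x
    have "ramp (x + h) - ramp x = 0" if "x \<notin> {-1-h..1}"
      using that assms by (auto simp: ramp_def max_def min_def)
    moreover have "(ramp (x + h) - ramp x)\<^sup>2 \<le> (min h 2)\<^sup>2"
      using assms by (intro power_mono) (auto simp: ramp_def max_def min_def)
    ultimately show "ennreal ((ramp (x + h) - ramp x)\<^sup>2) \<le> ennreal ((min h 2)\<^sup>2) * indicator {-1-h..1} x"
      by (auto simp: indicator_def intro!: ennreal_leI)
  qed
  also have "\<dots> = ennreal ((min h 2)\<^sup>2) * ennreal (2 + h)"
    using assms by (subst nn_integral_cmult_indicator) (auto simp: add.commute)
  also have "\<dots> = ennreal ((min h 2)\<^sup>2 * (2 + h))"
    using assms by (simp add: ennreal_mult)
  finally show ?thesis .
qed

text \<open>The shifts are split at 1. Short ones give \<open>3 / (2 - 2 * s)\<close>, where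
  \<open>s < 1\<close> makes the kernel integrable at 0; long ones are bounded through
  \<open>4 * h + 8\<close>, and only the linear term produces a contribution singular at
  \<open>s = 1/2\<close>.\<close>

lemma gagliardo_energy_ramp_le:
  assumes s: "1/2 < s" "s < 1"
  shows "gagliardo_energy s UNIV ramp \<le> ennreal (2 * (3 / (2 - 2 * s) + (4 / (2 * s - 1) + 8 / (2 * s))))"
proof -
  have I0: "(\<integral>\<^sup>+h. ennreal (h powr (1 - 2 * s)) * indicator {0..1} h \<partial>lborel) = ennreal (1 / (2 - 2 * s))"
  proof -
    have "((\<lambda>h. h powr (1 - 2 * s)) has_integral (1 powr (1 - 2 * s + 1) / (1 - 2 * s + 1))) {0..1}"
      using s by (intro has_integral_powr_from_0) auto
    then have "((\<lambda>h. h powr (1 - 2 * s)) has_integral (1 / (2 - 2 * s))) {0..1}"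
      by simp
    then show ?thesis by (rule nn_integral_has_integral_lebesgue'[rotated]) simp
  qed
  have "(\<integral>\<^sup>+h\<in>{0<..}. ennreal (h powr (-1 - 2 * s)) *
          (\<integral>\<^sup>+x. ennreal ((ramp (x + h) - ramp x)\<^sup>2) \<partial>lborel) \<partial>lborel)
    \<le> (\<integral>\<^sup>+h. 3 * (ennreal (h powr (1 - 2 * s)) * indicator {0..1} h)
         + (4 * (ennreal (h powr (- 2 * s)) * indicator {1..} h)
         + 8 * (ennreal (h powr (-1 - 2 * s)) * indicator {1..} h)) \<partial>lborel)"
  proof (intro nn_integral_mono)
    fix h :: real
    let ?r = "3 * (ennreal (h powr (1 - 2 * s)) * indicator {0..1} h)
         + (4 * (ennreal (h powr (- 2 * s)) * indicator {1..} h)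
         + 8 * (ennreal (h powr (-1 - 2 * s)) * indicator {1..} h))"
    show "ennreal (h powr (-1 - 2 * s)) * (\<integral>\<^sup>+x. ennreal ((ramp (x + h) - ramp x)\<^sup>2) \<partial>lborel)
        * indicator {0<..} h \<le> ?r"
    proof (cases "h > 0")
      case h: True
      have "ennreal (h powr (-1 - 2 * s)) * (\<integral>\<^sup>+x. ennreal ((ramp (x + h) - ramp x)\<^sup>2) \<partial>lborel)
          \<le> ennreal (h powr (-1 - 2 * s)) * ennreal ((min h 2)\<^sup>2 * (2 + h))"
        using ramp_increment_le[OF h] by (intro mult_left_mono) auto
      also have "\<dots> = ennreal (h powr (-1 - 2 * s) * ((min h 2)\<^sup>2 * (2 + h)))"
        by (simp add: ennreal_mult')
      also have "\<dots> \<le> ?r"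
      proof (cases "h < 1")
        case True
        \<comment> \<open>Here \<open>min h 2 = h\<close>, and its square raises the kernel exponent
          by 2; the constant 3 bounds \<open>2 + h\<close>.\<close>
        have "h powr (-1 - 2 * s) * h\<^sup>2 = h powr (1 - 2 * s)"
          using h powr_add[of h "-1 - 2 * s" 2] by simp
        then have "h powr (-1 - 2 * s) * ((min h 2)\<^sup>2 * (2 + h)) = h powr (1 - 2 * s) * (2 + h)"
          using True by simp
        also have "\<dots> \<le> h powr (1 - 2 * s) * 3"
          using True by (intro mult_left_mono) auto
        finally have "ennreal (h powr (-1 - 2 * s) * ((min h 2)\<^sup>2 * (2 + h))) \<le> ennreal (3 * h powr (1 - 2 * s))"
          by (intro ennreal_leI) simp
        then show ?thesis using True h by (simp add: ennreal_mult')
      next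
        case False
        have e: "h powr (-1 - 2 * s) * h = h powr (-2 * s)"
          using h powr_add[of h "-1 - 2 * s" 1] by simp
        \<comment> \<open>This is lossy only for \<open>h < 2\<close>, a bounded range of shifts
          away from 0, so the leading constant 4 is kept.\<close>
        have "(min h 2)\<^sup>2 \<le> 2\<^sup>2" using h by (intro power_mono) auto
        then have "h powr (-1 - 2 * s) * ((min h 2)\<^sup>2 * (2 + h)) \<le> h powr (-1 - 2 * s) * (4 * (2 + h))"
          using h by (intro mult_left_mono mult_right_mono) auto
        also have "\<dots> = 4 * h powr (-2 * s) + 8 * h powr (-1 - 2 * s)"
          using e by (simp add: algebra_simps)
        finally have "ennreal (h powr (-1 - 2 * s) * ((min h 2)\<^sup>2 * (2 + h)))
            \<le> ennreal (4 * h powr (-2 * s) + 8 * h powr (-1 - 2 * s))"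
          by (intro ennreal_leI)
        also have "\<dots> = 4 * ennreal (h powr (-2 * s)) + 8 * ennreal (h powr (-1 - 2 * s))"
          by (simp add: ennreal_mult')
        also have "\<dots> \<le> ?r" using False by simp
        finally show ?thesis .
      qed
      finally show ?thesis using h by simp
    qed simp
  qed
  also have "\<dots> = 3 * ennreal (1 / (2 - 2 * s)) + (4 * ennreal (1 / (2 * s - 1)) + 8 * ennreal (1 / (2 * s)))"
    using s nn_integral_powr_tail[of "-2 * s" 1] nn_integral_powr_tail[of "-1 - 2 * s" 1]
    by (simp add: nn_integral_add nn_integral_cmult I0)
  also have "\<dots> = ennreal (3 / (2 - 2 * s) + (4 / (2 * s - 1) + 8 / (2 * s)))"
    using s ennreal_mult'[of 3 "1 / (2 - 2 * s)"] ennreal_mult'[of 4 "1 / (2 * s - 1)"]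
      ennreal_mult'[of 8 "1 / (2 * s)"] by simp
  finally show ?thesis
    unfolding gagliardo_energy_UNIV_eq[OF borel_measurable_ramp]
    using s by (simp only: ennreal_mult'[OF zero_le_numeral] ennreal_numeral) (intro mult_left_mono zero_le)
qed

text \<open>Local finiteness follows from the global energy bound, as restricting to an interval
  only shrinks the domain of integration.\<close>

lemma ramp_in_transitions:
  assumes s: "1/2 < s" "s < 1"
  shows "ramp \<in> transitions s"
proof -
  have "ramp \<in> Hs_on s {a<..<b}" if "a < b" for a b
  proof -
    have "set_borel_measurable lborel {a<..<b} ramp"
      unfolding set_borel_measurable_def by measurable
    moreover have "(\<integral>\<^sup>+x\<in>{a<..<b}. ennreal (\<bar>ramp x\<bar>\<^sup>2) \<partial>lborel) < \<infinity>"
    proof -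
      have "\<bar>ramp x\<bar>\<^sup>2 \<le> 1" for x
        using power_mono[of "\<bar>ramp x\<bar>" 1 2] by (auto simp: ramp_def)
      then have "(\<integral>\<^sup>+x\<in>{a<..<b}. ennreal (\<bar>ramp x\<bar>\<^sup>2) \<partial>lborel) \<le> (\<integral>\<^sup>+x. indicator {a<..<b} x \<partial>lborel)"
        by (intro nn_integral_mono) (auto simp: indicator_def)
      also have "\<dots> < \<infinity>" using that by simp
      finally show ?thesis .
    qed
    moreover have "gagliardo_energy s {a<..<b} ramp \<le> gagliardo_energy s UNIV ramp"
      unfolding gagliardo_energy_def by (intro nn_integral_mono) (auto simp: indicator_def)
    then have "gagliardo_energy s {a<..<b} ramp < \<infinity>"
      using gagliardo_energy_ramp_le[OF s] by (auto simp: less_top[symmetric] top_unique)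
    ultimately show ?thesis unfolding Hs_on_def by blast
  qed
  moreover have "(ramp \<longlongrightarrow> 1) at_top"
    by (rule tendsto_eventually, rule eventually_at_top_linorderI[of 1]) (auto simp: ramp_def)
  moreover have "(ramp \<longlongrightarrow> -1) at_bot"
    by (rule tendsto_eventually, rule eventually_at_bot_linorderI[of "-1"]) (auto simp: ramp_def)
  ultimately show ?thesis
    unfolding transitions_def Hs_loc_def using continuous_on_ramp by blast
qed

section \<open>Bounds for the infimum\<close>

lemma transition_cost_le:
  fixes W :: "real \<Rightarrow> real"
  assumes W: "\<And>z. z \<in> {-1..1} \<Longrightarrow> W z \<le> M" "W 1 = 0" "W (-1) = 0" and M: "M \<ge> 0"
    and s: "1/2 < s" "s < 1"
  shows "transition_cost W s \<le> ennreal (2 * M + 2 * (3 / (2 - 2 * s) + (4 / (2 * s - 1) + 8 / (2 * s))))"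
proof -
  \<comment> \<open>Outside [-1, 1] the ramp sits in a well, so the potential costs at most
    \<open>M\<close> times the length 2.\<close>
  have "(\<integral>\<^sup>+t. ennreal (W (ramp t)) \<partial>lborel) \<le> (\<integral>\<^sup>+t. ennreal M * indicator {-1..(1::real)} t \<partial>lborel)"
  proof (intro nn_integral_mono)
    fix t
    show "ennreal (W (ramp t)) \<le> ennreal M * indicator {-1..1} t"
    proof (cases "t \<in> {-1..1}")
      case True
      then have "W (ramp t) \<le> M" by (intro W(1)) (auto simp: ramp_def)
      with True show ?thesis by (simp add: ennreal_leI)
    next
      case False
      then have "ramp t = 1 \<or> ramp t = -1" by (auto simp: ramp_def)
      with W(2,3) show ?thesis by auto
    qed
  qed
  also have "\<dots> = ennreal (2 * M)"
    using M by (subst nn_integral_cmult_indicator) (auto simp: ennreal_mult' mult.commute)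
  finally have "(\<integral>\<^sup>+t. ennreal (W (ramp t)) \<partial>lborel) + gagliardo_energy s UNIV ramp
      \<le> ennreal (2 * M) + ennreal (2 * (3 / (2 - 2 * s) + (4 / (2 * s - 1) + 8 / (2 * s))))"
    using gagliardo_energy_ramp_le[OF s] by (rule add_mono)
  also have "\<dots> = ennreal (2 * M + 2 * (3 / (2 - 2 * s) + (4 / (2 * s - 1) + 8 / (2 * s))))"
    using s M by (subst ennreal_plus) auto
  finally show ?thesis
    unfolding transition_cost_def using ramp_in_transitions[OF s] by (rule INF_lower2[rotated])
qed

text \<open>Either the potential part alone exceeds \<open>8 / (2 * s - 1)\<close>, or it bounds the measure of the
  gap by \<open>8 / (c * (2 * s - 1))\<close>.\<close>
lemma transition_cost_ge:
  fixes W :: "real \<Rightarrow> real"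
  assumes W: "continuous_on UNIV W" "\<And>z. z \<in> {-1+d..1-d} \<Longrightarrow> c \<le> W z"
    and c: "c > 0" and d: "0 < d" "d < 1" and s: "1/2 < s"
  shows "ennreal (min 8 (8 * (1 - d)\<^sup>2 * ((8 / (c * (2 * s - 1))) powr (1 - 2 * s) / (2 * s))))
    \<le> ennreal (2 * s - 1) * transition_cost W s"
proof -
  define L where "L = 8 / (c * (2 * s - 1))"
  have L: "L > 0" using c s by (simp add: L_def)
  \<comment> \<open>The smaller of the two alternatives, each scaled by \<open>2 * s - 1\<close>.
    The choice of \<open>L\<close> makes \<open>c * L = 8 / (2 * s - 1)\<close>, so the case of a
    large gap yields exactly 8.\<close>
  define E where "E = min 8 (8 * (1 - d)\<^sup>2 * (L powr (1 - 2 * s) / (2 * s)))"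
  have "ennreal (E / (2 * s - 1)) \<le> (\<integral>\<^sup>+t. ennreal (W (u t)) \<partial>lborel) + gagliardo_energy s UNIV u"
    if "u \<in> transitions s" for u
  proof -
    have u: "continuous_on UNIV u" "(u \<longlongrightarrow> 1) at_top" "(u \<longlongrightarrow> -1) at_bot"
      using that by (auto simp: transitions_def)
    have [measurable]: "u \<in> borel_measurable borel" "W \<in> borel_measurable borel"
      using u(1) W(1) by (auto intro: borel_measurable_continuous_onI)
    define C where "C = {x. -1 + d \<le> u x \<and> u x \<le> 1 - d}"
    have [measurable]: "C \<in> sets borel" unfolding C_def by measurable
    show ?thesis
    proof (cases "emeasure lborel C \<le> ennreal L")
      case True
      have "ennreal (E / (2 * s - 1)) \<le> ennreal (8 * (1 - d)\<^sup>2 * (L powr (1 - 2 * s) / (2 * s)) / (2 * s - 1))"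
        using s by (intro ennreal_leI divide_right_mono) (auto simp: E_def)
      also have "\<dots> = ennreal (8 * (1 - d)\<^sup>2 * (L powr (1 - 2 * s) / (2 * s * (2 * s - 1))))"
        by simp
      also have "\<dots> \<le> gagliardo_energy s UNIV u"
        using True unfolding C_def by (rule gagliardo_energy_ge[OF u s L d])
      also have "\<dots> \<le> (\<integral>\<^sup>+t. ennreal (W (u t)) \<partial>lborel) + gagliardo_energy s UNIV u"
        by simp
      finally show ?thesis .
    next
      case False
      have "ennreal (E / (2 * s - 1)) \<le> ennreal (c * L)"
        using s c by (intro ennreal_leI) (auto simp: E_def L_def divide_right_mono)
      also have "\<dots> = ennreal c * ennreal L"
        using c by (simp add: ennreal_mult')
      also have "\<dots> \<le> ennreal c * emeasure lborel C"
        using False by (intro mult_left_mono) auto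
      also have "\<dots> = (\<integral>\<^sup>+t. ennreal c * indicator C t \<partial>lborel)"
        by (subst nn_integral_cmult_indicator) auto
      also have "\<dots> \<le> (\<integral>\<^sup>+t. ennreal (W (u t)) \<partial>lborel)"
        using W(2) by (intro nn_integral_mono) (auto simp: C_def indicator_def intro!: ennreal_leI)
      also have "\<dots> \<le> (\<integral>\<^sup>+t. ennreal (W (u t)) \<partial>lborel) + gagliardo_energy s UNIV u"
        by simp
      finally show ?thesis .
    qed
  qed
  then have "ennreal (E / (2 * s - 1)) \<le> transition_cost W s"
    unfolding transition_cost_def by (intro INF_greatest)
  then have "ennreal (2 * s - 1) * ennreal (E / (2 * s - 1)) \<le> ennreal (2 * s - 1) * transition_cost W s"
    by (intro mult_left_mono) auto
  also have "ennreal (2 * s - 1) * ennreal (E / (2 * s - 1)) = ennreal E"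
    using s by (subst ennreal_mult'[symmetric]) auto
  finally show ?thesis unfolding E_def L_def .
qed

section \<open>Passage to the limit\<close>

theorem lemma4p2:
  fixes W :: "real \<Rightarrow> real"
  assumes "continuous_on UNIV W"
    and "\<And>z. W z \<ge> 0"
    and "\<And>z. W z = 0 \<longleftrightarrow> z = 1 \<or> z = -1"
    and "Liminf at_top (\<lambda>z. ereal (W z)) > 0"
    and "Liminf at_bot (\<lambda>z. ereal (W z)) > 0"
  shows "((\<lambda>s. ennreal (2 * s - 1) * transition_cost W s) \<longlongrightarrow> 8) (at_right (1 / 2))"
proof (rule order_tendstoI)
  have near: "eventually (\<lambda>s::real. 1/2 < s \<and> s < 1) (at_right (1/2))"
    by (rule eventually_at_rightI[of _ 1]) auto
  fix a :: ennreal
  {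
    assume "a < 8"
    then obtain r where r: "a = ennreal r" "0 \<le> r" "r < 8"
      by (cases a) (auto simp: ennreal_less_iff simp flip: ennreal_numeral)
    \<comment> \<open>With this \<open>d\<close>, \<open>8 * (1 - d)\<^sup>2\<close> is at least
      \<open>8 - 16 * d = (8 + r) / 2\<close>, which exceeds \<open>r\<close>.\<close>
    define d where "d = (8 - r) / 32"
    have d: "0 < d" "d < 1" using r by (auto simp: d_def)
    have "1 - 2 * d \<le> (1 - d)\<^sup>2" by (simp add: power2_eq_square algebra_simps)
    then have r8: "r < 8 * (1 - d)\<^sup>2" using r(3) by (simp add: d_def field_simps)
    have ne: "{-1+d..1-d} \<noteq> {}" using d by simp
    \<comment> \<open>The compact interval avoids both wells, so the minimum of \<open>W\<close> on
      it is positive; it serves as the constant \<open>c\<close>.\<close>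
    obtain z0 where z0: "z0 \<in> {-1+d..1-d}" "\<And>z. z \<in> {-1+d..1-d} \<Longrightarrow> W z0 \<le> W z"
      using continuous_attains_inf[OF compact_Icc ne continuous_on_subset[OF assms(1)]] by auto
    define c where "c = W z0"
    have c: "c > 0"
      using z0(1) d assms(2)[of z0] assms(3)[of z0] by (auto simp: c_def less_le)
    have "((\<lambda>s. 8 * (1 - d)\<^sup>2 * ((8 / (c * (2 * s - 1))) powr (1 - 2 * s) / (2 * s)))
        \<longlongrightarrow> 8 * (1 - d)\<^sup>2 * 1) (at_right (1/2))"
    proof (intro tendsto_mult_left)
      \<comment> \<open>With \<open>x = 2 * s - 1\<close> the power is
        \<open>exp (- x * ln (8 / (c * x)))\<close>, and \<open>x * ln x\<close> tends to 0. The
        crude bound on the gap therefore costs nothing in the limit.\<close>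
      show "((\<lambda>s. (8 / (c * (2 * s - 1))) powr (1 - 2 * s) / (2 * s)) \<longlongrightarrow> 1) (at_right (1/2))"
        using c by real_asymp
    qed
    from order_tendstoD(1)[OF this, of r] r8
    have "eventually (\<lambda>s. r < 8 * (1 - d)\<^sup>2 * ((8 / (c * (2 * s - 1))) powr (1 - 2 * s) / (2 * s))) (at_right (1/2))"
      by simp
    with near show "eventually (\<lambda>s. a < ennreal (2 * s - 1) * transition_cost W s) (at_right (1/2))"
    proof eventually_elim
      case (elim s)
      have "a < ennreal (min 8 (8 * (1 - d)\<^sup>2 * ((8 / (c * (2 * s - 1))) powr (1 - 2 * s) / (2 * s))))"
        unfolding r(1) using elim r by (subst ennreal_less_iff) auto
      also have "\<dots> \<le> ennreal (2 * s - 1) * transition_cost W s"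
        using elim z0(2) by (intro transition_cost_ge[OF assms(1) _ c d]) (auto simp: c_def)
      finally show ?case .
    qed
  next
    assume "8 < a"
    have "\<exists>x\<in>{-1..1}. \<forall>z\<in>{-1..1}. W z \<le> W x"
      by (rule continuous_attains_sup) (auto intro: continuous_on_subset[OF assms(1)])
    then obtain z1 where z1: "\<And>z. z \<in> {-1..1} \<Longrightarrow> W z \<le> W z1" by blast
    define M where "M = W z1"
    have M: "M \<ge> 0" using assms(2) by (simp add: M_def)
    \<comment> \<open>After multiplication by \<open>2 * s - 1\<close> only
      \<open>2 * 4 / (2 * s - 1)\<close> survives in the limit, giving 8; the other terms stay
      bounded near 1/2 and are scaled to 0.\<close>
    define U where "U s = (2 * s - 1) * (2 * M + 2 * (3 / (2 - 2 * s) + (4 / (2 * s - 1) + 8 / (2 * s))))" for s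
    have "(U \<longlongrightarrow> 8) (at_right (1/2))"
      unfolding U_def[abs_def] by real_asymp
    then have "((\<lambda>s. ennreal (U s)) \<longlongrightarrow> ennreal 8) (at_right (1/2))"
      by (rule tendsto_ennrealI)
    from order_tendstoD(2)[OF this, of a] \<open>8 < a\<close>
    have "eventually (\<lambda>s. ennreal (U s) < a) (at_right (1/2))" by simp
    with near show "eventually (\<lambda>s. ennreal (2 * s - 1) * transition_cost W s < a) (at_right (1/2))"
    proof eventually_elim
      case (elim s)
      have "transition_cost W s \<le> ennreal (2 * M + 2 * (3 / (2 - 2 * s) + (4 / (2 * s - 1) + 8 / (2 * s))))"
        by (rule transition_cost_le) (use elim z1 M assms(3) in \<open>auto simp: M_def\<close>)
      then have "ennreal (2 * s - 1) * transition_cost W s \<le> ennreal (U s)"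
        unfolding U_def using elim by (subst ennreal_mult') (auto intro: mult_left_mono)
      with elim show ?case by simp
    qed
  }
qed

end
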